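(* Let $\mathcal{N}\subseteq\mathbb{Z}^d$ be a finite set, let $F$ be the XOR CA with neighbourhood $\mathcal{N}$ on $\{0,1\}^{\mathbb{Z}^d}$, and let $p,q\in(0,1)$. Then the PCA $\Phi$ obtained by combining $F$ with the positive zero-range noise with transition probabilities $0\to1$ with probability $p$ and $1\to0$ with probability $q$ is uniformly ergodic. Moreover, its unique invariant measure is spatially mixing.
   Context: Let $S=\{0,1\}$, identified with $\mathbb{Z}/2\mathbb{Z}$, $d\ge1$, $\mathcal{X}=S^{\mathbb{Z}^d}$ with the product topology. For finite $K\subseteq\mathbb{Z}^d$ and $y_K\in S^K$, the cylinder $[y_K]$ is $\{x\in\mathcal{X}: x_k=y_k\ \forall k\in K\}$. The shift is $(\sigma^k x)_i=x_{k+i}$. The XOR CA with neighbourhood $\mathcal{N}$ is $(Fx)_i=\sum_{j\in\mathcal{N}}x_{i+j}\pmod 2$. With noise matrix $\theta=\begin{pmatrix}1-p&p\\ q&1-q\end{pmatrix}$ (rows and columns indexed by $0,1$), $\Phi$ is the Markov kernel on $\mathcal{X}$ given by $\Phi(x,[y_K])=\prod_{k\in K}\theta\big((Fx)_k,y_k\big)$ for every cylinder. A Borel probability measure $\pi$ is invariant if $\pi\Phi=\pi$. $\Phi$ is uniformly ergodic if it has a unique invariant measure $\pi$ and $\Phi^t(x,[u])\to\pi([u])$ as $t\to\infty$, uniformly in $x\in\mathcal{X}$, for each cylinder $[u]$. $\pi$ is spatially mixing if $\lim_{k\to\infty}\pi([u]\cap\sigma^{-k}[v])=\pi([u])\pi([v])$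 for all cylinders $[u],[v]$. *)

theory Defs
  imports "HOL-Probability.Probability" "HOL-Library.Z2"
begin

instantiation bit :: discrete_topology
begin

definition open_bit :: "bit set \<Rightarrow> bool"
  where "open_bit U = True"

instance
  by standard (simp_all add: open_bit_def)

end

lemma UNIV_bit: "(UNIV :: bit set) = {0, 1}"
proof -
  have "x \<in> {0, 1}" for x :: bit by (cases x) auto
  then show ?thesis by blast
qed

instance bit :: finite
  by standard (simp add: UNIV_bit)

instance bit :: second_countable_topology
proof
  have "countable (UNIV :: bit set set)" by (rule countable_finite) simp
  moreover have "open = generate_topology (UNIV :: bit set set)"
    by (rule ext) (simp add: open_bit_def generate_topology.Basis)
  ultimately show "\<exists>B :: bit set set. countable B \<and> open = generate_topology B"
    by blast
qed

text \<open>
  Sites are elements of \<open>int ^ 'd\<close> with \<open>d = CARD('d)\<close>. Functions carry the product topology,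
  so \<open>borel\<close> on configurations is the Borel sigma-algebra of \<open>\<X>\<close>.
\<close>

type_synonym 'd config = "int ^ 'd \<Rightarrow> bit"

text \<open>Only the values of \<open>y\<close> on \<open>K\<close> matter, so a pattern \<open>y\<^sub>K\<close> is given by any \<open>y\<close> extending it.\<close>

definition cylinder :: "(int ^ 'd) set \<Rightarrow> 'd config \<Rightarrow> 'd config set"
  where "cylinder K y = {x. \<forall>k\<in>K. x k = y k}"

definition shift :: "int ^ 'd \<Rightarrow> 'd config \<Rightarrow> 'd config"
  where "shift k x = (\<lambda>i. x (k + i))"

definition xor_ca :: "(int ^ 'd) set \<Rightarrow> 'd config \<Rightarrow> 'd config"
  where "xor_ca N x = (\<lambda>i. \<Sum>j\<in>N. x (i + j))"

definition noise_matrix :: "real \<Rightarrow> real \<Rightarrow> bit \<Rightarrow> bit \<Rightarrow> real"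
  where "noise_matrix p q a b =
    (if a = 0 then (if b = 0 then 1 - p else p) else (if b = 0 then q else 1 - q))"

text \<open>
  The kernel \<open>\<Phi>\<close>: given \<open>x\<close>, the new symbols are independent, the one at site \<open>k\<close> having
  distribution \<open>\<theta> ((F x) k)\<close>. The lemma \<open>pca_kernel_unique\<close> below shows that this is the only
  family of Borel measures with the prescribed values on cylinders.
\<close>

definition pca_kernel ::
    "('d::finite config \<Rightarrow> 'd config) \<Rightarrow> (bit \<Rightarrow> bit \<Rightarrow> real) \<Rightarrow> 'd config \<Rightarrow> 'd config measure"
  where "pca_kernel F \<theta> x = (\<Pi>\<^sub>M k\<in>UNIV. point_measure UNIV (\<lambda>b. ennreal (\<theta> (F x k) b)))"

primrec kernel_power ::
    "('a::topological_space \<Rightarrow> 'a measure) \<Rightarrow> nat \<Rightarrow> 'a \<Rightarrow> 'a measure"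
  where
    "kernel_power \<Phi> 0 x = return borel x"
  | "kernel_power \<Phi> (Suc t) x = kernel_power \<Phi> t x \<bind> \<Phi>"

definition invariant_measure ::
    "('a::topological_space \<Rightarrow> 'a measure) \<Rightarrow> 'a measure \<Rightarrow> bool"
  where "invariant_measure \<Phi> \<pi> \<longleftrightarrow> prob_space \<pi> \<and> sets \<pi> = sets borel \<and> \<pi> \<bind> \<Phi> = \<pi>"

definition uniformly_ergodic :: "('d::finite config \<Rightarrow> 'd config measure) \<Rightarrow> bool"
  where "uniformly_ergodic \<Phi> \<longleftrightarrow>
    (\<exists>\<pi>. invariant_measure \<Phi> \<pi> \<and> (\<forall>\<pi>'. invariant_measure \<Phi> \<pi>' \<longrightarrow> \<pi>' = \<pi>) \<and>
      (\<forall>K u. finite K \<longrightarrow>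
        uniform_limit UNIV (\<lambda>t x. measure (kernel_power \<Phi> t x) (cylinder K u))
          (\<lambda>x. measure \<pi> (cylinder K u)) sequentially))"

text \<open>
  \<open>k \<rightarrow> \<infinity>\<close> in the lattice means that \<open>k\<close> leaves every finite set, i.e. \<open>\<bar>k\<bar> \<rightarrow> \<infinity>\<close>; this is the
  filter \<open>cofinite\<close> (see \<open>cofinite_lattice\<close> below).
\<close>

definition spatially_mixing :: "'d::finite config measure \<Rightarrow> bool"
  where "spatially_mixing \<pi> \<longleftrightarrow>
    (\<forall>K u L v. finite K \<longrightarrow> finite L \<longrightarrow>
      ((\<lambda>k. measure \<pi> (cylinder K u \<inter> shift k -` cylinder L v))
        \<longlongrightarrow> measure \<pi> (cylinder K u) * measure \<pi> (cylinder L v)) cofinite)"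

lemma cofinite_lattice:
  "(cofinite :: (int ^ 'd::finite) filter) = filtercomap (\<lambda>k. \<Sum>i\<in>UNIV. \<bar>k $ i\<bar>) at_top"
proof (rule antisym)
  have fin: "finite {k :: int ^ 'd. (\<Sum>i\<in>UNIV. \<bar>k $ i\<bar>) < n}" for n
  proof (rule finite_subset)
    show "{k :: int ^ 'd. (\<Sum>i\<in>UNIV. \<bar>k $ i\<bar>) < n} \<subseteq> vec_lambda ` (UNIV \<rightarrow>\<^sub>E {- n..n})"
    proof
      fix k :: "int ^ 'd"
      assume "k \<in> {k. (\<Sum>i\<in>UNIV. \<bar>k $ i\<bar>) < n}"
      then have lt: "(\<Sum>i\<in>UNIV. \<bar>k $ i\<bar>) < n" by simp
      have le: "\<bar>k $ j\<bar> \<le> (\<Sum>i\<in>UNIV. \<bar>k $ i\<bar>)" for j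
        by (rule member_le_sum) auto
      have "\<bar>k $ j\<bar> \<le> n" for j
        using le[of j] lt by linarith
      then have "vec_nth k \<in> UNIV \<rightarrow>\<^sub>E {- n..n}"
        by (simp add: PiE_UNIV_domain abs_le_iff minus_le_iff)
      then have "vec_lambda (vec_nth k) \<in> vec_lambda ` (UNIV \<rightarrow>\<^sub>E {- n..n})"
        by (rule imageI)
      then show "k \<in> vec_lambda ` (UNIV \<rightarrow>\<^sub>E {- n..n})"
        by simp
    qed
    show "finite (vec_lambda ` ((UNIV :: 'd set) \<rightarrow>\<^sub>E {- n..n}) :: (int ^ 'd) set)"
      by (intro finite_imageI finite_PiE) auto
  qed
  show "cofinite \<le> filtercomap (\<lambda>k :: int ^ 'd. \<Sum>i\<in>UNIV. \<bar>k $ i\<bar>) at_top"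
    unfolding filterlim_iff_le_filtercomap[symmetric] filterlim_at_top
    using fin by (auto simp: eventually_cofinite not_le)
  show "filtercomap (\<lambda>k :: int ^ 'd. \<Sum>i\<in>UNIV. \<bar>k $ i\<bar>) at_top \<le> cofinite"
  proof (rule filter_leI)
    fix P :: "int ^ 'd \<Rightarrow> bool"
    let ?f = "\<lambda>k :: int ^ 'd. \<Sum>i\<in>UNIV. \<bar>k $ i\<bar>"
    assume "eventually P cofinite"
    then have f: "finite {k. \<not> P k}" by (simp add: eventually_cofinite)
    define m where "m = Max (insert 0 (?f ` {k. \<not> P k})) + 1"
    have "P k" if "m \<le> ?f k" for k
    proof (rule ccontr)
      assume "\<not> P k"
      then have "?f k \<le> Max (insert 0 (?f ` {k. \<not> P k}))"
        using f by (intro Max_ge) auto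
      with that show False by (simp add: m_def)
    qed
    then show "eventually P (filtercomap ?f at_top)"
      unfolding eventually_filtercomap_at_top_linorder by blast
  qed
qed

lemma prob_space_noise:
  assumes "0 \<le> p" "p \<le> 1" "0 \<le> q" "q \<le> 1"
  shows "prob_space (point_measure UNIV (\<lambda>b. ennreal (noise_matrix p q a b)))"
proof (rule prob_space_point_measure)
  show "(\<Sum>s\<in>UNIV. ennreal (noise_matrix p q a s)) = 1"
    using assms by (auto simp: UNIV_bit noise_matrix_def simp flip: ennreal_plus)
qed (use assms in \<open>auto simp: noise_matrix_def UNIV_bit\<close>)

lemma sets_pca_kernel: "sets (pca_kernel F \<theta> x) = sets borel"
proof -
  have b: "sets (borel :: bit measure) = UNIV"
    by (auto intro!: borel_open simp: open_bit_def)
  show ?thesis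
    unfolding pca_kernel_def sets_PiM_equal_borel[symmetric]
    by (intro sets_PiM_cong refl) (simp add: sets_point_measure b)
qed

lemma cylinder_eq_emb:
  assumes "\<And>k. space (M k) = UNIV"
  shows "cylinder K y = prod_emb UNIV M K (\<Pi>\<^sub>E k\<in>K. {y k})"
  by (auto simp: cylinder_def prod_emb_def assms PiE_iff space_PiM)

lemma emeasure_pca_kernel_cylinder:
  assumes "0 \<le> p" "p \<le> 1" "0 \<le> q" "q \<le> 1" "finite K"
  shows "emeasure (pca_kernel F (noise_matrix p q) x) (cylinder K y) =
    ennreal (\<Prod>k\<in>K. noise_matrix p q (F x k) (y k))"
proof -
  let ?M = "\<lambda>k. point_measure UNIV (\<lambda>b. ennreal (noise_matrix p q (F x k) b))"
  have *: "cylinder K y = prod_emb UNIV ?M K (\<Pi>\<^sub>E k\<in>K. {y k})"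
    by (rule cylinder_eq_emb) (simp add: space_point_measure)
  have nn: "0 \<le> noise_matrix p q a b" for a b
    using assms by (auto simp: noise_matrix_def)
  have "emeasure (pca_kernel F (noise_matrix p q) x) (cylinder K y) =
      (\<Prod>k\<in>K. emeasure (?M k) {y k})"
    unfolding pca_kernel_def *
    by (rule emeasure_PiM_emb) (use assms in \<open>auto intro: prob_space_noise simp: sets_point_measure\<close>)
  also have "\<dots> = (\<Prod>k\<in>K. ennreal (noise_matrix p q (F x k) (y k)))"
    by (intro prod.cong refl, subst emeasure_point_measure_finite) auto
  also have "\<dots> = ennreal (\<Prod>k\<in>K. noise_matrix p q (F x k) (y k))"
    by (intro prod_ennreal nn)
  finally show ?thesis .
qed

lemma prob_space_pca_kernel:
  assumes "0 \<le> p" "p \<le> 1" "0 \<le> q" "q \<le> 1"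
  shows "prob_space (pca_kernel F (noise_matrix p q) x)"
  unfolding pca_kernel_def by (intro prob_space_PiM prob_space_noise assms)

definition cylinders :: "'d::finite config set set"
  where "cylinders = insert {} {cylinder K y | K y. finite K}"

lemma Int_stable_cylinders: "Int_stable cylinders"
proof (rule Int_stableI)
  fix A B :: "'d::finite config set"
  assume AB: "A \<in> cylinders" "B \<in> cylinders"
  show "A \<inter> B \<in> cylinders"
  proof (cases "A \<inter> B = {}")
    case True
    then show ?thesis by (simp add: cylinders_def)
  next
    case False
    then obtain z where z: "z \<in> A" "z \<in> B" by blast
    obtain K y L w where A: "A = cylinder K y" "finite K" and B: "B = cylinder L w" "finite L"
      using AB z unfolding cylinders_def by blast
    have "A \<inter> B = cylinder (K \<union> L) z"
      using z unfolding A B cylinder_def by auto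
    then show ?thesis using A B unfolding cylinders_def by blast
  qed
qed

lemma sets_borel_cylinders:
  "sets (borel :: 'd::finite config measure) = sigma_sets UNIV cylinders"
proof -
  have b: "sets (borel :: bit measure) = UNIV"
    by (auto intro!: borel_open simp: open_bit_def)
  have 1: "{f :: 'd config. f i \<in> A} \<in> sigma_sets UNIV cylinders" for i A
  proof -
    have "{f :: 'd config. f i \<in> A} = (\<Union>a\<in>A. cylinder {i} (\<lambda>_. a))"
      by (auto simp: cylinder_def)
    also have "\<dots> \<in> sigma_sets UNIV cylinders"
    proof -
      interpret sigma_algebra UNIV "sigma_sets UNIV (cylinders :: 'd config set set)"
        by (rule sigma_algebra_sigma_sets) simp
      show ?thesis
        by (rule finite_UN) (auto simp: cylinders_def)
    qed
    finally show ?thesis .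
  qed
  have 2: "cylinder K y \<in> sets (borel :: 'd config measure)" if "finite K" for K y
  proof -
    have "cylinder K y = prod_emb UNIV (\<lambda>_. borel) K (\<Pi>\<^sub>E k\<in>K. {y k})"
      by (rule cylinder_eq_emb) simp
    also have "\<dots> \<in> sets (\<Pi>\<^sub>M k\<in>UNIV. borel)"
      using that by (intro sets_PiM_I) (auto simp: b)
    finally show ?thesis by (simp add: sets_PiM_equal_borel)
  qed
  show ?thesis
  proof
    have "UNIV \<rightarrow>\<^sub>E space (borel :: bit measure) = (UNIV :: 'd config set)"
      by (simp add: PiE_UNIV_domain)
    then show "sets (borel :: 'd config measure) \<subseteq> sigma_sets UNIV cylinders"
      unfolding sets_PiM_equal_borel[symmetric] sets_PiM_single
      by (auto intro!: sigma_sets_mono 1)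
    show "sigma_sets UNIV cylinders \<subseteq> sets (borel :: 'd config measure)"
      by (rule sets.sigma_sets_subset[of _ borel, simplified]) (use 2 in \<open>auto simp: cylinders_def\<close>)
  qed
qed

lemma pca_kernel_unique:
  fixes P :: "'d::finite config measure"
  assumes pq: "0 \<le> p" "p \<le> 1" "0 \<le> q" "q \<le> 1"
    and P: "sets P = sets borel"
    and cyl: "\<And>K y. finite K \<Longrightarrow>
      emeasure P (cylinder K y) = ennreal (\<Prod>k\<in>K. noise_matrix p q (F x k) (y k))"
  shows "P = pca_kernel F (noise_matrix p q) x"
proof (rule measure_eqI_generator_eq[OF Int_stable_cylinders, of UNIV])
  have U: "UNIV = cylinder {} (\<lambda>_. 0)" by (simp add: cylinder_def)
  show "range (\<lambda>_ :: nat. UNIV) \<subseteq> (cylinders :: 'd config set set)"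
    unfolding cylinders_def using U by blast
  show "emeasure P UNIV \<noteq> \<infinity>" for i :: nat
    using cyl[of "{}" "\<lambda>_. 0"] by (simp add: cylinder_def)
  show "emeasure P A = emeasure (pca_kernel F (noise_matrix p q) x) A" if Acyl: "A \<in> cylinders" for A
  proof (cases "A = {}")
    case False
    then obtain K y where A: "A = cylinder K y" and K: "finite K"
      using Acyl unfolding cylinders_def by blast
    show ?thesis
      unfolding A cyl[OF K] emeasure_pca_kernel_cylinder[OF pq K] ..
  qed simp
qed (simp_all add: P sets_pca_kernel sets_borel_cylinders)

lemma measurable_xor_ca:
  "xor_ca N \<in> borel \<rightarrow>\<^sub>M (borel :: 'd::finite config measure)"
proof -
  have "(\<lambda>x :: 'd config. \<Sum>j\<in>N. x (i + j)) \<in> borel \<rightarrow>\<^sub>M (borel :: bit measure)" for i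
  proof (rule borel_measurable_continuous_onI)
    have c: "continuous_on UNIV (\<lambda>x :: 'd config. x k)" for k
      by (rule continuous_on_product_coordinates)
    have p: "continuous_on UNIV (\<lambda>x :: 'd config. f x + g x)"
      if "continuous_on UNIV f" "continuous_on UNIV g" for f g :: "'d config \<Rightarrow> bit"
    proof -
      have "(\<lambda>x. f x + g x) -` B = (\<Union>a. f -` {a} \<inter> g -` {b. a + b \<in> B})" for B
        by auto
      moreover have o: "open (f -` A)" "open (g -` A)" for A
        using that by (auto simp: continuous_on_open_vimage open_bit_def)
      ultimately have "open ((\<lambda>x. f x + g x) -` B)" for B
        by (simp only:) (intro open_UN ballI open_Int o)
      then show ?thesis
        by (simp only: continuous_on_open_vimage[OF open_UNIV]) simp
    qed
    show "continuous_on UNIV (\<lambda>x :: 'd config. \<Sum>j\<in>N. x (i + j))"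
      by (induction N rule: infinite_finite_induct) (simp_all only: sum.infinite sum.empty sum.insert not_False_eq_True continuous_on_const p c)
  qed
  then have "xor_ca N \<in> borel \<rightarrow>\<^sub>M (\<Pi>\<^sub>M k\<in>UNIV. (borel :: bit measure))"
    unfolding xor_ca_def by (intro measurable_PiM_single') auto
  then show ?thesis
    by (simp add: measurable_cong_sets[OF refl sets_PiM_equal_borel])
qed

lemma measurable_pca_kernel:
  assumes pq: "0 \<le> p" "p \<le> 1" "0 \<le> q" "q \<le> 1"
    and F: "F \<in> borel \<rightarrow>\<^sub>M (borel :: 'd::finite config measure)"
  shows "pca_kernel F (noise_matrix p q) \<in> borel \<rightarrow>\<^sub>M prob_algebra borel"
proof (rule measurable_prob_algebra_generated[OF sets_borel_cylinders Int_stable_cylinders])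
  fix A :: "'d config set" assume "A \<in> cylinders"
  then consider "A = {}" | K y where "finite K" "A = cylinder K y"
    by (auto simp: cylinders_def)
  then show "(\<lambda>a. emeasure (pca_kernel F (noise_matrix p q) a) A) \<in> borel_measurable borel"
  proof cases
    case 2
    have "(\<lambda>x. F x k) \<in> borel \<rightarrow>\<^sub>M (borel :: bit measure)" for k
      by (rule measurable_compose[OF F borel_measurable_continuous_onI])
        (rule continuous_on_product_coordinates)
    moreover have "(\<lambda>a. noise_matrix p q a b) \<in> borel \<rightarrow>\<^sub>M borel" for b
      by (intro borel_measurable_continuous_onI) (simp add: continuous_on_open_vimage open_bit_def)
    ultimately have "(\<lambda>x. noise_matrix p q (F x k) b) \<in> borel \<rightarrow>\<^sub>M borel" for k b
      by (rule measurable_compose)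
    then show ?thesis
      unfolding 2 emeasure_pca_kernel_cylinder[OF pq \<open>finite K\<close>]
      by (intro measurable_compose[OF _ measurable_ennreal] borel_measurable_prod)
  qed simp
qed (auto simp: sets_pca_kernel prob_space_pca_kernel pq)

end

theory Submission
  imports Defs
begin

text \<open>
  Let \<open>\<chi>\<^sub>A\<close> be the character \<open>x \<mapsto> \<Prod>k\<in>A. (-1) ^ x k\<close>. One step of the PCA sends \<open>\<chi>\<^sub>A\<close> to
  \<open>\<Prod>a\<in>A. ((1 - p - q) (\<chi>\<^sub>a \<circ> F) + (q - p))\<close>. Since \<open>F\<close> is linear, expanding the product gives a
  combination of characters whose coefficients have absolute sum at most
  \<open>(\<bar>1 - p - q\<bar> + \<bar>q - p\<bar>) ^ card A\<close>. As \<open>\<bar>1 - p - q\<bar> + \<bar>q - p\<bar> = max \<bar>1 - 2p\<bar> \<bar>1 - 2q\<bar> < 1\<close>,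
  this dual evolution of Fourier coefficients is a contraction away from \<open>A = {}\<close>, whatever the
  initial configuration, and the limiting coefficients define the invariant measure. Mixing follows
  because the dual evolution up to a fixed time only looks at a bounded neighbourhood of \<open>A\<close> and so
  factorises over distant sets.
\<close>

section \<open>Fourier coefficients of measures on configurations\<close>

definition spin :: "bit \<Rightarrow> real"
  where "spin b = (if b = 0 then 1 else - 1)"

lemma spin_simps [simp]: "spin 0 = 1" "spin 1 = - 1"
  by (simp_all add: spin_def)

lemma abs_spin [simp]: "\<bar>spin b\<bar> = 1"
  by (simp add: spin_def)

lemma spin_add: "spin (a + b) = spin a * spin b"
  by (cases a; cases b) simp_all

lemma spin_sum: "spin (\<Sum>i\<in>I. f i) = (\<Prod>i\<in>I. spin (f i))"
  by (induction I rule: infinite_finite_induct)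
    (simp_all only: sum.infinite prod.infinite sum.empty prod.empty sum.insert prod.insert
      not_False_eq_True spin_add spin_simps)

lemma spin_power: "spin b ^ n = (if odd n then spin b else 1)"
  by (cases b) simp_all

lemma spin_mult_eq: "1 + spin a * spin b = (if a = b then 2 else 0)"
  by (cases a; cases b) simp_all

text \<open>For finite \<open>A\<close> these are the Walsh functions, the continuous characters of
  the compact group of configurations. For infinite \<open>A\<close> the product is 1 by
  convention.\<close>

definition character :: "(int ^ 'd) set \<Rightarrow> 'd config \<Rightarrow> real"
  where "character A x = (\<Prod>k\<in>A. spin (x k))"

lemma character_empty [simp]: "character {} x = 1"
  by (simp add: character_def)

lemma abs_character [simp]: "\<bar>character A x\<bar> = 1"
  by (simp add: character_def abs_prod)

lemma character_cases: "character A x = 1 \<or> character A x = - 1"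
  using abs_character[of A x] by linarith

lemma character_Un:
  "finite A \<Longrightarrow> finite B \<Longrightarrow> A \<inter> B = {} \<Longrightarrow> character (A \<union> B) x = character A x * character B x"
  by (simp add: character_def prod.union_disjoint)

lemma character_shift: "character A (shift k x) = character ((+) k ` A) x"
  by (simp add: character_def shift_def prod.reindex)

text \<open>The factor \<open>(1 + spin (y k) * spin (x k)) / 2\<close> is 1 if
  \<open>x k = y k\<close> and 0 otherwise. Expanding the product of these factors over
  \<open>K\<close> gives one term for each subset \<open>B\<close>.\<close>

lemma indicator_cylinder:
  assumes "finite K"
  shows "indicator (cylinder K y) x = (\<Sum>B\<in>Pow K. character B y * character B x) / 2 ^ card K"
proof -
  have "(\<Sum>B\<in>Pow K. character B y * character B x) =
      (\<Sum>B\<in>Pow K. (\<Prod>k\<in>B. spin (y k) * spin (x k)) * (\<Prod>k\<in>K - B. 1))"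
    by (simp add: character_def prod.distrib)
  also have "\<dots> = (\<Prod>k\<in>K. spin (y k) * spin (x k) + 1)"
    by (rule prod_add[OF assms, symmetric])
  also have "\<dots> = (\<Prod>k\<in>K. if x k = y k then 2 else 0)"
    by (intro prod.cong refl) (auto simp: spin_mult_eq add.commute)
  also have "\<dots> = 2 ^ card K * indicator (cylinder K y) x"
  proof (cases "x \<in> cylinder K y")
    case True
    then have "(\<Prod>k\<in>K. if x k = y k then 2 else 0 :: real) = (\<Prod>k\<in>K. 2)"
      by (intro prod.cong) (auto simp: cylinder_def)
    with True show ?thesis by simp
  next
    case False
    then have "\<exists>k\<in>K. (if x k = y k then 2 else 0 :: real) = 0"
      by (auto simp: cylinder_def)
    with False assms show ?thesis by (simp add: prod_zero)
  qed
  finally show ?thesis by simp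
qed

text \<open>A character is constant on each cylinder over \<open>A\<close>, and these cylinders
  partition the space. Extensional patterns count each of them once; only
  \<open>restrict x A\<close> contributes at \<open>x\<close>.\<close>

lemma character_fourier_inversion:
  assumes "finite A"
  shows "character A x = (\<Sum>y\<in>A \<rightarrow>\<^sub>E UNIV. character A y * indicator (cylinder A y) x)"
proof -
  have "(\<Sum>y\<in>A \<rightarrow>\<^sub>E UNIV. character A y * indicator (cylinder A y) x) =
      (\<Sum>y\<in>{restrict x A}. character A y * indicator (cylinder A y) x)"
  proof (rule sum.mono_neutral_right)
    show "finite (A \<rightarrow>\<^sub>E (UNIV :: bit set))"
      using assms by (intro finite_PiE) auto
    show "\<forall>y\<in>(A \<rightarrow>\<^sub>E UNIV) - {restrict x A}. character A y * indicator (cylinder A y) x = 0"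
    proof
      fix y assume y: "y \<in> (A \<rightarrow>\<^sub>E UNIV) - {restrict x A}"
      then have "x \<notin> cylinder A y"
        by (auto simp: cylinder_def PiE_def extensional_def fun_eq_iff restrict_def) metis
      then show "character A y * indicator (cylinder A y) x = 0" by simp
    qed
  qed auto
  also have "\<dots> = character A x"
    by (simp add: character_def cylinder_def)
  finally show ?thesis ..
qed

lemma cylinder_in_borel [measurable]: "finite K \<Longrightarrow> cylinder K y \<in> sets borel"
  unfolding sets_borel_cylinders by (rule sigma_sets.Basic) (auto simp: cylinders_def)

lemma borel_measurable_character [measurable]:
  assumes "finite A"
  shows "character A \<in> borel_measurable borel"
  using assms by (subst character_fourier_inversion[OF assms, abs_def]) measurable

definition fourier :: "'d config measure \<Rightarrow> (int ^ 'd) set \<Rightarrow> real"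
  where "fourier \<mu> A = (\<integral>x. character A x \<partial>\<mu>)"

text \<open>The set on which a character equals \<open>- 1\<close> turns statements about measures of sets into
  statements about Fourier coefficients.\<close>

definition odd_set :: "(int ^ 'd) set \<Rightarrow> 'd config set"
  where "odd_set A = {x. character A x = - 1}"

lemma character_odd_set: "character A x = 1 - 2 * indicator (odd_set A) x"
  using character_cases[of A x] by (auto simp: odd_set_def indicator_def)

lemma odd_set_in_borel [measurable]:
  fixes A :: "(int ^ 'd::finite) set"
  assumes "finite A"
  shows "odd_set A \<in> sets borel"
proof -
  have "{x \<in> space borel. character A x = - 1} \<in> sets borel"
    using assms by measurable
  then show ?thesis by (simp add: odd_set_def)
qed

locale config_prob = prob_space \<mu> for \<mu> :: "'d::finite config measure" +
  assumes sets_eq [measurable_cong, simp]: "sets \<mu> = sets borel"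
begin

lemma space_eq [simp]: "space \<mu> = UNIV"
  using sets_eq_imp_space_eq[OF sets_eq] by simp

lemma integrable_character [simp]: "finite A \<Longrightarrow> integrable \<mu> (character A)"
  by (rule integrable_const_bound[where B = 1]) (auto intro: borel_measurable_character)

lemma fourier_empty [simp]: "fourier \<mu> {} = 1"
  by (simp add: fourier_def prob_space[simplified])

lemma fourier_odd_set: "finite A \<Longrightarrow> fourier \<mu> A = 1 - 2 * prob (odd_set A)"
  unfolding fourier_def character_odd_set
  by (subst Bochner_Integration.integral_diff) (auto simp: prob_space[simplified] less_top[symmetric])

lemma abs_fourier_le: "finite A \<Longrightarrow> \<bar>fourier \<mu> A\<bar> \<le> 1"
  using measure_nonneg[of \<mu> "odd_set A"] prob_le_1[of "odd_set A"]
  by (simp only: fourier_odd_set abs_le_iff) linarith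

lemma integrable_sum_character:
  "(\<And>i. i \<in> I \<Longrightarrow> finite (S i)) \<Longrightarrow> integrable \<mu> (\<lambda>x. \<Sum>i\<in>I. c i * character (S i) x)"
  by (intro Bochner_Integration.integrable_sum Bochner_Integration.integrable_mult_right)
    (simp add: integrable_character)

lemma expectation_sum_character:
  assumes "\<And>i. i \<in> I \<Longrightarrow> finite (S i)"
  shows "(\<integral>x. (\<Sum>i\<in>I. c i * character (S i) x) \<partial>\<mu>) = (\<Sum>i\<in>I. c i * fourier \<mu> (S i))"
  unfolding fourier_def using assms
  by (subst Bochner_Integration.integral_sum)
    (auto intro!: Bochner_Integration.integrable_mult_right)

lemma prob_cylinder:
  assumes "finite K"
  shows "prob (cylinder K y) = (\<Sum>B\<in>Pow K. character B y * fourier \<mu> B) / 2 ^ card K"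
proof -
  have "prob (cylinder K y) = (\<integral>x. indicator (cylinder K y) x \<partial>\<mu>)"
    using assms by simp
  also have "\<dots> = (\<Sum>B\<in>Pow K. character B y * fourier \<mu> B) / 2 ^ card K"
    unfolding indicator_cylinder[OF assms] integral_divide_zero
    using assms finite_subset by (subst expectation_sum_character) auto
  finally show ?thesis .
qed

text \<open>Converse of \<open>prob_cylinder\<close>: through it the product formula for the kernel
  on cylinders becomes a formula for Fourier coefficients.\<close>

lemma fourier_conv_prob_cylinder:
  assumes "finite A"
  shows "fourier \<mu> A = (\<Sum>y\<in>A \<rightarrow>\<^sub>E UNIV. character A y * prob (cylinder A y))"
proof -
  have "cylinder A y \<in> sets \<mu>" for y using assms by simp
  then have "integrable \<mu> (\<lambda>x. indicator (cylinder A y) x :: real)" for y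
    by (intro integrable_real_indicator) (auto simp: less_top[symmetric])
  moreover have "fourier \<mu> A =
      (\<integral>x. (\<Sum>y\<in>A \<rightarrow>\<^sub>E UNIV. character A y * indicator (cylinder A y) x) \<partial>\<mu>)"
    unfolding fourier_def
    by (rule Bochner_Integration.integral_cong[OF refl character_fourier_inversion[OF assms]])
  ultimately show ?thesis
    by (simp add: Bochner_Integration.integral_sum)
qed

end

text \<open>Fourier coefficients fix the probabilities of cylinders, and the cylinders are an
  intersection-stable generator of the Borel sets.\<close>

lemma config_prob_eqI:
  assumes "config_prob \<mu>" "config_prob \<nu>"
    and eq: "\<And>A. finite A \<Longrightarrow> fourier \<mu> A = fourier \<nu> A"
  shows "\<mu> = \<nu>"
proof (rule measure_eqI_generator_eq[OF Int_stable_cylinders, of UNIV _ _ "\<lambda>_. UNIV"])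
  interpret \<mu>: config_prob \<mu> by fact
  interpret \<nu>: config_prob \<nu> by fact
  have "UNIV = cylinder {} (\<lambda>_. 0)" by (simp add: cylinder_def)
  then show "range (\<lambda>_ :: nat. UNIV) \<subseteq> (cylinders :: 'a config set set)"
    unfolding cylinders_def by blast
  show "emeasure \<mu> A = emeasure \<nu> A" if Acyl: "A \<in> cylinders" for A
  proof (cases "A = {}")
    case False
    then obtain K y where A: "A = cylinder K y" and K: "finite K"
      using Acyl unfolding cylinders_def by blast
    have "fourier \<mu> B = fourier \<nu> B" if "B \<in> Pow K" for B
      using that K by (intro eq) (auto intro: finite_subset)
    then have "\<mu>.prob A = \<nu>.prob A"
      unfolding A by (simp add: \<mu>.prob_cylinder[OF K] \<nu>.prob_cylinder[OF K])
    then show ?thesis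
      by (simp add: \<mu>.emeasure_eq_measure \<nu>.emeasure_eq_measure)
  qed simp
  show "sets \<mu> = sigma_sets UNIV cylinders" "sets \<nu> = sigma_sets UNIV cylinders"
    by (simp_all add: sets_borel_cylinders)
  show "emeasure \<mu> UNIV \<noteq> \<infinity>"
    by simp
qed simp_all

section \<open>Limits of measures\<close>

text \<open>The clopen sets, as the algebra on which a premeasure will be built. One implication
  suffices because agreement on \<open>K\<close> is symmetric in \<open>x\<close> and
  \<open>y\<close>.\<close>

definition local_sets :: "'d config set set"
  where "local_sets = {A. \<exists>K. finite K \<and> (\<forall>x y. (\<forall>k\<in>K. x k = y k) \<longrightarrow> x \<in> A \<longrightarrow> y \<in> A)}"

lemma local_sets_Compl:
  assumes "A \<in> local_sets"
  shows "- A \<in> local_sets"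
proof -
  from assms obtain K where K: "finite K" "\<And>x y. (\<forall>k\<in>K. x k = y k) \<Longrightarrow> x \<in> A \<Longrightarrow> y \<in> A"
    unfolding local_sets_def by blast
  have "y \<in> - A" if "\<forall>k\<in>K. x k = y k" "x \<in> - A" for x y
    using K(2)[of y x] that by auto
  with K(1) show ?thesis unfolding local_sets_def by blast
qed

lemma local_sets_Un:
  assumes "A \<in> local_sets" "B \<in> local_sets"
  shows "A \<union> B \<in> local_sets"
proof -
  from assms(1) obtain K where K: "finite K" "\<And>x y. (\<forall>k\<in>K. x k = y k) \<Longrightarrow> x \<in> A \<Longrightarrow> y \<in> A"
    unfolding local_sets_def by blast
  from assms(2) obtain L where L: "finite L" "\<And>x y. (\<forall>k\<in>L. x k = y k) \<Longrightarrow> x \<in> B \<Longrightarrow> y \<in> B"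
    unfolding local_sets_def by blast
  have "y \<in> A \<union> B" if "\<forall>k\<in>K \<union> L. x k = y k" "x \<in> A \<union> B" for x y
    using K(2)[of x y] L(2)[of x y] that by auto
  moreover have "finite (K \<union> L)" using K(1) L(1) by simp
  ultimately show ?thesis unfolding local_sets_def by blast
qed

lemma cylinder_in_local_sets: "finite K \<Longrightarrow> cylinder K y \<in> local_sets"
  unfolding local_sets_def cylinder_def by force

lemma odd_set_in_local_sets: "finite A \<Longrightarrow> odd_set A \<in> local_sets"
  unfolding local_sets_def odd_set_def character_def by force

lemma algebra_local_sets: "algebra UNIV local_sets"
proof -
  have "{} \<in> local_sets" by (auto simp: local_sets_def)
  then show ?thesis
    by (auto simp: algebra_iff_Un local_sets_Un local_sets_Compl simp flip: Compl_eq_Diff_UNIV)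
qed

text \<open>All cylinders are taken over one common \<open>K\<close>. They are finitely many because
  \<open>bit\<close> is finite, and distinct ones are disjoint, so measures of local sets are finite
  sums of cylinder probabilities.\<close>

lemma local_sets_cylinders:
  assumes "A \<in> local_sets"
  obtains K where "finite K" "finite (cylinder K ` A)" "A = \<Union>(cylinder K ` A)"
proof -
  from assms obtain K where K: "finite K" "\<And>x y. (\<forall>k\<in>K. x k = y k) \<Longrightarrow> x \<in> A \<Longrightarrow> y \<in> A"
    unfolding local_sets_def by blast
  have "cylinder K y = cylinder K (restrict y K)" for y :: "'a config"
    by (simp add: cylinder_def)
  then have "cylinder K ` A \<subseteq> cylinder K ` (K \<rightarrow>\<^sub>E UNIV)"
    by (metis (no_types, lifting) UNIV_I image_eqI image_subsetI restrict_PiE_iff)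
  moreover have "finite (K \<rightarrow>\<^sub>E (UNIV :: bit set))"
    using K(1) by (intro finite_PiE) auto
  ultimately have "finite (cylinder K ` A)"
    using finite_subset by blast
  moreover have "A = \<Union>(cylinder K ` A)"
    using K(2) by (auto simp: cylinder_def) metis
  ultimately show ?thesis using that K(1) by blast
qed

lemma local_sets_borel:
  fixes A :: "'d::finite config set"
  assumes "A \<in> local_sets"
  shows "A \<in> sets borel"
proof -
  obtain K where K: "finite K" "finite (cylinder K ` A)" "A = \<Union>(cylinder K ` A)"
    using assms by (rule local_sets_cylinders)
  have "\<Union>(cylinder K ` A) \<in> sets borel"
    using K by (intro sets.finite_Union) auto
  with K show ?thesis by simp
qed

lemma sigma_sets_local_sets:
  "sigma_sets UNIV local_sets = sets (borel :: 'd::finite config measure)"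
proof (rule equalityI)
  have "(cylinders :: 'd config set set) \<subseteq> local_sets"
    by (auto simp: cylinders_def cylinder_in_local_sets) (auto simp: local_sets_def)
  then show "sets borel \<subseteq> sigma_sets UNIV (local_sets :: 'd config set set)"
    unfolding sets_borel_cylinders by (rule sigma_sets_mono')
  show "sigma_sets UNIV (local_sets :: 'd config set set) \<subseteq> sets borel"
    by (rule sets.sigma_sets_subset[of _ borel, simplified]) (auto intro: local_sets_borel)
qed

text \<open>Tychonoff's theorem for a product of finite discrete spaces.\<close>

lemma compact_UNIV_config: "compact (UNIV :: 'd::finite config set)"
proof -
  have "compact_space (euclidean :: bit topology)"
    by (simp add: compact_space_def finite_imp_compact)
  then have "compact_space (product_topology (\<lambda>_. euclidean :: bit topology) (UNIV :: (int ^ 'd) set))"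
    by (simp add: compact_space_product_topology)
  then show ?thesis
    by (simp add: euclidean_product_topology compact_space_def)
qed

lemma open_cylinder: "finite K \<Longrightarrow> open (cylinder K y)"
  using product_topology_basis'[of K "\<lambda>k. {y k}" "\<lambda>k. k"]
  by (simp add: cylinder_def open_bit_def)

lemma closed_local_sets:
  fixes A :: "'d::finite config set"
  assumes "A \<in> local_sets"
  shows "closed A"
proof -
  obtain K where K: "finite K" "- A = \<Union>(cylinder K ` (- A))"
    using local_sets_cylinders[OF local_sets_Compl[OF assms]] by metis
  have "open (\<Union>(cylinder K ` (- A)))"
    using K(1) by (auto intro: open_cylinder)
  with K show ?thesis by (simp add: closed_def)
qed

lemma decseq_local_sets_empty:
  fixes A :: "nat \<Rightarrow> 'd::finite config set"
  assumes "range A \<subseteq> local_sets" "decseq A" "(\<Inter>i. A i) = {}"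
  shows "\<exists>i. A i = {}"
proof (rule ccontr)
  assume ne: "\<nexists>i. A i = {}"
  have "UNIV \<inter> (\<Inter>i\<in>UNIV. A i) \<noteq> {}"
  proof (rule compact_imp_fip_image[OF compact_UNIV_config])
    show "closed (A i)" for i
      using assms(1) by (intro closed_local_sets) auto
    fix I :: "nat set"
    assume "finite I"
    \<comment> \<open>In a decreasing sequence the set with the largest index lies in all the
      others. Inserting 0 keeps \<open>Max\<close> meaningful for empty \<open>I\<close>.\<close>
    then have "A (Max (insert 0 I)) \<subseteq> A i" if "i \<in> I" for i
      using that by (intro decseqD[OF assms(2)]) simp
    then have "A (Max (insert 0 I)) \<subseteq> (\<Inter>i\<in>I. A i)" by blast
    with ne show "UNIV \<inter> (\<Inter>i\<in>I. A i) \<noteq> {}" by fast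
  qed
  with assms(3) show False by simp
qed

text \<open>Finitely additive limits on the algebra of local sets are automatically continuous at the
  empty set, because a decreasing sequence of nonempty clopen sets has a common point.\<close>

lemma config_prob_limit:
  fixes M :: "nat \<Rightarrow> 'd::finite config measure"
  assumes M: "\<And>t. config_prob (M t)"
    and c: "\<And>A. finite A \<Longrightarrow> (\<lambda>t. fourier (M t) A) \<longlonglongrightarrow> c A"
  obtains \<pi> where "config_prob \<pi>" "\<And>A. finite A \<Longrightarrow> fourier \<pi> A = c A"
proof -
  interpret M: config_prob "M t" for t by (rule M)
  interpret algebra UNIV "local_sets :: 'd config set set" by (rule algebra_local_sets)
  define m where "m A = lim (\<lambda>t. measure (M t) A)" for A
  \<comment> \<open>Cylinder probabilities are finite linear combinations of Fourier coefficients,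
    which converge by assumption.\<close>
  have cyl: "convergent (\<lambda>t. measure (M t) (cylinder K y))" if K: "finite K" for K y
  proof -
    have "(\<lambda>t. (\<Sum>B\<in>Pow K. character B y * fourier (M t) B) / 2 ^ card K)
        \<longlonglongrightarrow> (\<Sum>B\<in>Pow K. character B y * c B) / 2 ^ card K"
      using K finite_subset by (intro tendsto_intros c) auto
    then show ?thesis
      unfolding M.prob_cylinder[OF K] by (rule convergentI)
  qed
  have lim: "(\<lambda>t. measure (M t) A) \<longlonglongrightarrow> m A" if A: "A \<in> local_sets" for A
  proof -
    obtain K where K: "finite K" "finite (cylinder K ` A)" "A = \<Union>(cylinder K ` A)"
      using A by (rule local_sets_cylinders)
    have "pairwise disjnt (cylinder K ` A)"
      by (auto simp: pairwise_def disjnt_def cylinder_def)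
    then have "measure (M t) (\<Union>(cylinder K ` A)) = (\<Sum>C\<in>cylinder K ` A. measure (M t) C)" for t
      using K by (intro measure_Union') (auto simp: M.fmeasurable_eq_sets)
    then have "measure (M t) A = (\<Sum>C\<in>cylinder K ` A. measure (M t) C)" for t
      by (simp flip: K(3))
    moreover have "convergent (\<lambda>t. \<Sum>C\<in>cylinder K ` A. measure (M t) C)"
      using cyl[OF K(1)] by (intro convergent_sum) auto
    ultimately show ?thesis
      unfolding m_def by (simp add: convergent_LIMSEQ_iff)
  qed
  have nonneg: "0 \<le> m A" if "A \<in> local_sets" for A
    using lim[OF that] by (rule LIMSEQ_le_const) simp
  have m_empty: "m {} = 0" by (simp add: m_def)
  have m_UNIV: "m UNIV = 1"
    using M.prob_space by (simp add: m_def)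
  have m_Un: "m (A \<union> B) = m A + m B" if "A \<in> local_sets" "B \<in> local_sets" "A \<inter> B = {}" for A B
  proof (rule LIMSEQ_unique)
    show "(\<lambda>t. measure (M t) (A \<union> B)) \<longlonglongrightarrow> m (A \<union> B)"
      using that by (intro lim local_sets_Un)
    show "(\<lambda>t. measure (M t) (A \<union> B)) \<longlonglongrightarrow> m A + m B"
      using tendsto_add[OF lim[OF that(1)] lim[OF that(2)]] that
      by (simp add: M.finite_measure_Union local_sets_borel)
  qed
  have "\<exists>\<mu>. (\<forall>A\<in>local_sets. \<mu> A = ennreal (m A)) \<and>
      measure_space UNIV (sigma_sets UNIV (local_sets :: 'd config set set)) \<mu>"
  proof (rule caratheodory_empty_continuous)
    show "positive local_sets (\<lambda>A. ennreal (m A))"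
      by (simp add: positive_def m_empty)
    show "additive local_sets (\<lambda>A. ennreal (m A))"
      by (simp add: additive_def m_Un nonneg)
    show "(\<lambda>i. ennreal (m (A i))) \<longlonglongrightarrow> 0"
      if A: "range A \<subseteq> local_sets" "decseq A" "(\<Inter>i. A i) = {}" for A
    proof -
      obtain i where i: "A i = {}" using decseq_local_sets_empty[OF A] ..
      have "A j = {}" if "i \<le> j" for j
        using decseqD[OF A(2) that] i by simp
      then have "\<forall>\<^sub>F j in sequentially. ennreal (m (A j)) = 0"
        unfolding eventually_sequentially by (metis m_empty ennreal_0)
      then show ?thesis by (rule tendsto_eventually)
    qed
  qed simp
  then obtain \<mu> where \<mu>: "\<And>A. A \<in> local_sets \<Longrightarrow> \<mu> A = ennreal (m A)"
    and space: "measure_space UNIV (sets (borel :: 'd config measure)) \<mu>"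
    unfolding sigma_sets_local_sets by blast
  define \<pi> where "\<pi> = measure_of UNIV (sets borel) \<mu>"
  have sets: "sets \<pi> = sets borel"
    unfolding \<pi>_def using sets.sigma_sets_eq[of "borel :: 'd config measure"] by simp
  have em: "emeasure \<pi> A = ennreal (m A)" if "A \<in> local_sets" for A
    unfolding \<pi>_def using space that
    by (subst emeasure_measure_of_sigma) (auto simp: measure_space_def \<mu> local_sets_borel)
  interpret \<pi>: config_prob \<pi>
  proof (intro config_prob.intro prob_spaceI config_prob_axioms.intro)
    show "emeasure \<pi> (space \<pi>) = 1"
      using em[of UNIV] m_UNIV top sets_eq_imp_space_eq[OF sets] by simp
  qed (fact sets)
  show thesis
  proof
    show "config_prob \<pi>" ..
    fix A :: "(int ^ 'd) set" assume A: "finite A"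
    \<comment> \<open>\<open>odd_set A\<close> is a local set, so its measure under
      \<open>\<pi>\<close> is by construction the limit of its measures under
      \<open>M t\<close>.\<close>
    have "(\<lambda>t. fourier (M t) A) \<longlonglongrightarrow> fourier \<pi> A"
      unfolding M.fourier_odd_set[OF A] \<pi>.fourier_odd_set[OF A]
      using lim[OF odd_set_in_local_sets[OF A]] em[OF odd_set_in_local_sets[OF A]]
        nonneg[OF odd_set_in_local_sets[OF A]]
      by (auto intro!: tendsto_intros simp: measure_def)
    then show "fourier \<pi> A = c A"
      using c[OF A] LIMSEQ_unique by blast
  qed
qed

section \<open>The dual evolution\<close>

text \<open>The Minkowski sum of \<open>A\<close> and \<open>N\<close>: the sites that
  \<open>xor_ca N x\<close> reads to compute its values on \<open>A\<close>.\<close>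

definition lattice_nbhd :: "(int ^ 'd) set \<Rightarrow> (int ^ 'd) set \<Rightarrow> (int ^ 'd) set"
  where "lattice_nbhd N A = (\<Union>a\<in>A. (+) a ` N)"

text \<open>Sites hit an even number of times drop out because \<open>spin b ^ 2 = 1\<close>.\<close>

definition dual :: "(int ^ 'd) set \<Rightarrow> (int ^ 'd) set \<Rightarrow> (int ^ 'd) set"
  where "dual N A = {i. odd (card {(a, j). a \<in> A \<and> j \<in> N \<and> a + j = i})}"

lemma dual_empty [simp]: "dual N {} = {}"
  by (simp add: dual_def)

lemma finite_lattice_nbhd: "finite N \<Longrightarrow> finite A \<Longrightarrow> finite (lattice_nbhd N A)"
  by (simp add: lattice_nbhd_def)

lemma lattice_nbhd_mono: "A \<subseteq> B \<Longrightarrow> lattice_nbhd N A \<subseteq> lattice_nbhd N B"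
  by (auto simp: lattice_nbhd_def)

lemma lattice_nbhd_translate: "lattice_nbhd N ((+) k ` A) = (+) k ` lattice_nbhd N A"
  by (simp add: lattice_nbhd_def image_UN image_image add.assoc)

lemma dual_subset: "dual N A \<subseteq> lattice_nbhd N A"
proof
  fix i assume "i \<in> dual N A"
  then have "card {(a, j). a \<in> A \<and> j \<in> N \<and> a + j = i} \<noteq> 0"
    unfolding dual_def by (auto intro: ccontr)
  then have "{(a, j). a \<in> A \<and> j \<in> N \<and> a + j = i} \<noteq> {}"
    using card.empty by metis
  then show "i \<in> lattice_nbhd N A"
    by (auto simp: lattice_nbhd_def)
qed

lemma finite_dual: "finite N \<Longrightarrow> finite A \<Longrightarrow> finite (dual N A)"
  by (rule finite_subset[OF dual_subset finite_lattice_nbhd])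

lemma dual_translate: "dual N ((+) k ` A) = (+) k ` dual N A"
proof -
  have "bij_betw (\<lambda>(a, j). (k + a, j)) {(a, j). a \<in> A \<and> j \<in> N \<and> a + j = i}
      {(a, j). a \<in> (+) k ` A \<and> j \<in> N \<and> a + j = k + i}" for i
    by (rule bij_betwI[where g = "\<lambda>(a, j). (a - k, j)"]) (auto simp: algebra_simps)
  from bij_betw_same_card[OF this]
  have *: "k + i \<in> dual N ((+) k ` A) \<longleftrightarrow> i \<in> dual N A" for i
    by (simp add: dual_def)
  have "i \<in> dual N ((+) k ` A) \<longleftrightarrow> i - k \<in> dual N A" for i
    using *[of "i - k"] by simp
  moreover have "i \<in> (+) k ` S \<longleftrightarrow> i - k \<in> S" for i S
    by (auto simp: image_iff intro: bexI[of _ "i - k"])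
  ultimately show ?thesis by blast
qed

lemma mem_dual_Un:
  assumes "i \<notin> lattice_nbhd N B"
  shows "i \<in> dual N (A \<union> B) \<longleftrightarrow> i \<in> dual N A"
proof -
  have "{(a, j). a \<in> A \<union> B \<and> j \<in> N \<and> a + j = i} = {(a, j). a \<in> A \<and> j \<in> N \<and> a + j = i}"
    using assms by (auto simp: lattice_nbhd_def)
  then show ?thesis
    unfolding dual_def mem_Collect_eq by (rule arg_cong)
qed

text \<open>Sites reached from both sets could cancel modulo 2; disjoint neighbourhoods rule this
  out.\<close>

lemma dual_Un:
  assumes "lattice_nbhd N A \<inter> lattice_nbhd N B = {}"
  shows "dual N (A \<union> B) = dual N A \<union> dual N B"
proof (rule set_eqI)
  fix i
  consider "i \<notin> lattice_nbhd N A" | "i \<notin> lattice_nbhd N B"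
    using assms by blast
  then show "i \<in> dual N (A \<union> B) \<longleftrightarrow> i \<in> dual N A \<union> dual N B"
  proof cases
    case 1
    with mem_dual_Un[OF 1, of B] dual_subset[of N A] show ?thesis
      by (auto simp: Un_commute)
  next
    case 2
    with mem_dual_Un[OF 2, of A] dual_subset[of N B] show ?thesis
      by auto
  qed
qed

text \<open>Composing a character with the linear map \<open>xor_ca N\<close> gives a character
  again. The factors of the double product over \<open>A\<close> and \<open>N\<close> are grouped by
  the site \<open>a + j\<close>, and only the parity of each group matters.\<close>

lemma character_dual:
  assumes "finite N" "finite A"
  shows "character (dual N A) x = character A (xor_ca N x)"
proof -
  let ?S = "\<lambda>i. {p. p \<in> A \<times> N \<and> (\<lambda>(a, j). a + j) p = i}"
  have S: "?S i = {(a, j). a \<in> A \<and> j \<in> N \<and> a + j = i}" for i by auto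
  have "character A (xor_ca N x) = (\<Prod>(a, j)\<in>A \<times> N. spin (x (a + j)))"
    by (simp add: character_def xor_ca_def spin_sum prod.cartesian_product)
  also have "\<dots> = (\<Prod>p\<in>A \<times> N. spin (x ((\<lambda>(a, j). a + j) p)))"
    by (simp add: case_prod_unfold)
  also have "\<dots> = (\<Prod>i\<in>lattice_nbhd N A. \<Prod>p\<in>?S i. spin (x ((\<lambda>(a, j). a + j) p)))"
    using assms unfolding lattice_nbhd_def by (intro prod.group[symmetric]) auto
  also have "\<dots> = (\<Prod>i\<in>lattice_nbhd N A. \<Prod>p\<in>?S i. spin (x i))"
    by (intro prod.cong refl) auto
  also have "\<dots> = (\<Prod>i\<in>lattice_nbhd N A. if i \<in> dual N A then spin (x i) else 1)"
    by (simp only: prod_constant spin_power S dual_def mem_Collect_eq)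
  also have "\<dots> = character (dual N A) x"
    unfolding character_def using assms dual_subset[of N A]
    by (simp add: prod.If_cases finite_lattice_nbhd Int_absorb1)
  finally show ?thesis ..
qed

text \<open>The action of the kernel on Fourier coefficients. In the expansion of the product over
  \<open>A\<close>, the set \<open>B\<close> holds the sites where the spin term with factor
  \<open>1 - p - q\<close> is chosen; the others contribute the constant
  \<open>q - p\<close>.\<close>

definition dual_step ::
    "(int ^ 'd) set \<Rightarrow> real \<Rightarrow> real \<Rightarrow> ((int ^ 'd) set \<Rightarrow> real) \<Rightarrow> (int ^ 'd) set \<Rightarrow> real"
  where "dual_step N p q m A =
    (\<Sum>B\<in>Pow A. (1 - p - q) ^ card B * (q - p) ^ card (A - B) * m (dual N B))"

lemma sum_Pow_power:
  fixes a b :: "'a::comm_semiring_1"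
  shows "finite A \<Longrightarrow> (\<Sum>B\<in>Pow A. a ^ card B * b ^ card (A - B)) = (a + b) ^ card A"
  using prod_add[of A "\<lambda>_. a" "\<lambda>_. b"] by simp

section \<open>Contraction of the dual step\<close>

definition noise_rate :: "real \<Rightarrow> real \<Rightarrow> real"
  where "noise_rate p q = \<bar>1 - p - q\<bar> + \<bar>q - p\<bar>"

text \<open>At nonempty \<open>A\<close> the weights have absolute sum
  \<open>noise_rate p q ^ card A\<close>, and the induction hypothesis bounds all differences at
  \<open>dual N B\<close> uniformly in \<open>B\<close>. At \<open>A = {}\<close> the weight is 1,
  but there both sequences agree. General \<open>f\<close> and \<open>g\<close> allow a comparison
  of kernel powers with a fixed point or with their own time shift.\<close>

lemma dual_step_contraction:
  assumes N: "finite N" and rate: "noise_rate p q \<le> 1"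
    and zero: "\<And>t. f t {} = g t {}"
    and base: "\<And>A. finite A \<Longrightarrow> \<bar>f 0 A - g 0 A\<bar> \<le> C"
    and f: "\<And>t A. finite A \<Longrightarrow> f (Suc t) A = dual_step N p q (f t) A"
    and g: "\<And>t A. finite A \<Longrightarrow> g (Suc t) A = dual_step N p q (g t) A"
    and A: "finite A"
  shows "\<bar>f t A - g t A\<bar> \<le> C * noise_rate p q ^ t"
  using A
proof (induction t arbitrary: A)
  case 0
  then show ?case using base by simp
next
  case (Suc t)
  have C: "0 \<le> C" using base[of "{}"] by auto
  have r0: "0 \<le> noise_rate p q" by (simp add: noise_rate_def)
  show ?case
  proof (cases "A = {}")
    case True
    then show ?thesis using zero C r0 by simp
  next
    case False
    let ?w = "\<lambda>B. (1 - p - q) ^ card B * (q - p) ^ card (A - B)"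
    have "f (Suc t) A - g (Suc t) A = (\<Sum>B\<in>Pow A. ?w B * (f t (dual N B) - g t (dual N B)))"
      using Suc.prems by (simp add: f g dual_step_def sum_subtractf right_diff_distrib)
    also have "\<bar>\<dots>\<bar> \<le> (\<Sum>B\<in>Pow A. \<bar>?w B\<bar> * (C * noise_rate p q ^ t))"
    proof (rule order_trans[OF sum_abs sum_mono])
      fix B assume "B \<in> Pow A"
      then have "finite (dual N B)"
        using Suc.prems N finite_dual finite_subset by blast
      then show "\<bar>?w B * (f t (dual N B) - g t (dual N B))\<bar> \<le> \<bar>?w B\<bar> * (C * noise_rate p q ^ t)"
        unfolding abs_mult[of "?w B"] by (intro mult_left_mono Suc.IH) auto
    qed
    also have "\<dots> = noise_rate p q ^ card A * (C * noise_rate p q ^ t)"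
      using sum_Pow_power[OF Suc.prems, of "\<bar>1 - p - q\<bar>" "\<bar>q - p\<bar>"]
      by (simp add: noise_rate_def abs_mult power_abs flip: sum_distrib_right)
    \<comment> \<open>Nonemptiness of \<open>A\<close> gives \<open>card A \<ge> 1\<close>, so at
      least one factor of the rate is gained.\<close>
    also have "\<dots> \<le> noise_rate p q ^ 1 * (C * noise_rate p q ^ t)"
      using False Suc.prems rate r0 C
      by (intro mult_right_mono power_decreasing) (auto simp: card_gt_0_iff Suc_le_eq)
    finally show ?thesis by (simp add: mult_ac)
  qed
qed

text \<open>The constant 1 lists the Fourier coefficients of the point mass at the zero
  configuration. It is translation invariant and multiplicative over unions, and the iterates keep
  the first property and, over separated finite sets, the second.\<close>

primrec dual_iterate ::
    "(int ^ 'd) set \<Rightarrow> real \<Rightarrow> real \<Rightarrow> nat \<Rightarrow> (int ^ 'd) set \<Rightarrow> real"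
  where
    "dual_iterate N p q 0 = (\<lambda>_. 1)"
  | "dual_iterate N p q (Suc t) = dual_step N p q (dual_iterate N p q t)"

section \<open>Translation invariance and factorisation of the iterates\<close>

lemma dual_step_translate:
  assumes "\<And>B. m ((+) k ` B) = m B"
  shows "dual_step N p q m ((+) k ` A) = dual_step N p q m A"
proof -
  have "(\<Sum>B\<in>Pow ((+) k ` A).
        (1 - p - q) ^ card B * (q - p) ^ card ((+) k ` A - B) * m (dual N B)) =
      (\<Sum>B\<in>Pow A.
        (1 - p - q) ^ card ((+) k ` B) * (q - p) ^ card ((+) k ` A - (+) k ` B) * m (dual N ((+) k ` B)))"
    unfolding image_Pow_surj[OF refl, symmetric]
    by (subst sum.reindex) (auto intro!: inj_on_image_Pow)
  also have "\<dots> = (\<Sum>B\<in>Pow A. (1 - p - q) ^ card B * (q - p) ^ card (A - B) * m (dual N B))"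
    by (intro sum.cong refl arg_cong2[where f = "(*)"])
      (simp_all add: dual_translate assms card_image image_set_diff[symmetric, OF inj_on_add])
  finally show ?thesis by (simp add: dual_step_def)
qed

lemma dual_iterate_translate: "dual_iterate N p q t ((+) k ` A) = dual_iterate N p q t A"
  by (induction t arbitrary: A) (simp_all add: dual_step_translate)

text \<open>The neighbourhoods of \<open>A\<close> and \<open>B\<close> stay disjoint at each of the
  steps 0 to \<open>t\<close>. Every step is checked because for empty \<open>N\<close> disjoint
  neighbourhoods say nothing about the sets themselves.\<close>

fun separated :: "(int ^ 'd) set \<Rightarrow> nat \<Rightarrow> (int ^ 'd) set \<Rightarrow> (int ^ 'd) set \<Rightarrow> bool"
  where
    "separated N 0 A B \<longleftrightarrow> A \<inter> B = {}"
  | "separated N (Suc t) A B \<longleftrightarrow>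
      A \<inter> B = {} \<and> separated N t (lattice_nbhd N A) (lattice_nbhd N B)"

lemma separated_disjoint: "separated N t A B \<Longrightarrow> A \<inter> B = {}"
  by (cases t) auto

lemma separated_mono: "separated N t A B \<Longrightarrow> A' \<subseteq> A \<Longrightarrow> B' \<subseteq> B \<Longrightarrow> separated N t A' B'"
proof (induction t arbitrary: A B A' B')
  case 0
  then show ?case unfolding separated.simps by blast
next
  case (Suc t)
  have "separated N t (lattice_nbhd N A) (lattice_nbhd N B)"
    using Suc.prems(1) by simp
  then have "separated N t (lattice_nbhd N A') (lattice_nbhd N B')"
    by (rule Suc.IH[OF _ lattice_nbhd_mono[OF Suc.prems(2)] lattice_nbhd_mono[OF Suc.prems(3)]])
  moreover have "A' \<inter> B' = {}"
    using Suc.prems unfolding separated.simps by blast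
  ultimately show ?case by simp
qed

text \<open>A subset of \<open>A \<union> B\<close> splits uniquely into
  \<open>C \<subseteq> A\<close> and \<open>D \<subseteq> B\<close>. The weights multiply since
  cardinalities add, and \<open>dual N (C \<union> D)\<close> is a union of sets separated for the
  remaining \<open>t\<close> steps, so the double sum factorises.\<close>

lemma dual_iterate_Un:
  assumes N: "finite N" and "finite A" "finite B" "separated N t A B"
  shows "dual_iterate N p q t (A \<union> B) = dual_iterate N p q t A * dual_iterate N p q t B"
  using assms(2-)
proof (induction t arbitrary: A B)
  case (Suc t)
  let ?m = "dual_iterate N p q t"
  let ?w = "\<lambda>A B. (1 - p - q) ^ card B * (q - p) ^ card (A - B)"
  have disj: "A \<inter> B = {}" and sep: "separated N t (lattice_nbhd N A) (lattice_nbhd N B)"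
    using Suc.prems by auto
  have *: "?w (A \<union> B) (C \<union> D) * ?m (dual N (C \<union> D)) =
      (?w A C * ?m (dual N C)) * (?w B D * ?m (dual N D))" if "C \<in> Pow A" "D \<in> Pow B" for C D
  proof -
    have fin: "finite C" "finite D"
      using that Suc.prems finite_subset by auto
    have "A \<union> B - (C \<union> D) = (A - C) \<union> (B - D)"
      using that disj by auto
    then have "card (A \<union> B - (C \<union> D)) = card (A - C) + card (B - D)"
      using Suc.prems disj by (simp add: card_Un_disjoint Int_Diff Diff_Int_distrib2 disjoint_iff)
    moreover have "card (C \<union> D) = card C + card D"
      using that disj fin by (intro card_Un_disjoint) auto
    moreover have sCD: "separated N t (lattice_nbhd N C) (lattice_nbhd N D)"
      using that by (intro separated_mono[OF sep] lattice_nbhd_mono) auto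
    then have "dual N (C \<union> D) = dual N C \<union> dual N D"
      by (intro dual_Un separated_disjoint)
    moreover have "separated N t (dual N C) (dual N D)"
      by (rule separated_mono[OF sCD dual_subset dual_subset])
    moreover have "?m (dual N C \<union> dual N D) = ?m (dual N C) * ?m (dual N D)"
      if "separated N t (dual N C) (dual N D)"
      using that fin N by (intro Suc.IH finite_dual)
    ultimately show ?thesis by (simp add: power_add mult_ac)
  qed
  have bij: "bij_betw (\<lambda>(C, D). C \<union> D) (Pow A \<times> Pow B) (Pow (A \<union> B))"
    using disj by (intro bij_betwI[where g = "\<lambda>E. (E \<inter> A, E \<inter> B)"]) auto
  have "dual_iterate N p q (Suc t) (A \<union> B) =
      (\<Sum>(C, D)\<in>Pow A \<times> Pow B. ?w (A \<union> B) (C \<union> D) * ?m (dual N (C \<union> D)))"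
    using sum.reindex_bij_betw[OF bij, of "\<lambda>E. ?w (A \<union> B) E * ?m (dual N E)"]
    by (simp add: dual_step_def case_prod_unfold)
  also have "\<dots> = (\<Sum>(C, D)\<in>Pow A \<times> Pow B. (?w A C * ?m (dual N C)) * (?w B D * ?m (dual N D)))"
    by (intro sum.cong refl) (use * in auto)
  also have "\<dots> = dual_iterate N p q (Suc t) A * dual_iterate N p q (Suc t) B"
    by (simp add: dual_step_def sum_product sum.cartesian_product)
  finally show ?case .
qed simp

text \<open>\<open>A\<close> meets the translate of \<open>B\<close> by \<open>k\<close> only if
  \<open>k\<close> is one of the finitely many differences \<open>a - b\<close>. Neighbourhoods
  commute with translation, so the same argument applies at every later step.\<close>

lemma finite_not_separated:
  assumes "finite N" "finite A" "finite B"
  shows "finite {k. \<not> separated N t A ((+) k ` B)}"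
  using assms(2,3)
proof (induction t arbitrary: A B)
  have inter: "finite {k. A \<inter> (+) k ` B \<noteq> {}}" if "finite A" "finite B" for A B :: "(int ^ 'd) set"
  proof (rule finite_subset)
    show "{k. A \<inter> (+) k ` B \<noteq> {}} \<subseteq> (\<lambda>(a, b). a - b) ` (A \<times> B)"
    proof
      fix k assume "k \<in> {k. A \<inter> (+) k ` B \<noteq> {}}"
      then obtain b where "k + b \<in> A" "b \<in> B" by auto
      then show "k \<in> (\<lambda>(a, b). a - b) ` (A \<times> B)"
        by (intro image_eqI[where x = "(k + b, b)"]) auto
    qed
  qed (use that in simp)
  {
    case 0
    then show ?case using inter by simp
  next
    case (Suc t)
    have "finite ({k. A \<inter> (+) k ` B \<noteq> {}} \<union>
        {k. \<not> separated N t (lattice_nbhd N A) ((+) k ` lattice_nbhd N B)})"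
      using Suc.prems assms(1) by (intro finite_UnI inter Suc.IH finite_lattice_nbhd)
    then show ?case
      by (rule finite_subset[rotated]) (auto simp: lattice_nbhd_translate)
  }
qed

section \<open>The noisy XOR CA\<close>

lemma noise_rate_less_1: "0 < p \<Longrightarrow> p < 1 \<Longrightarrow> 0 < q \<Longrightarrow> q < 1 \<Longrightarrow> noise_rate p q < 1"
  unfolding noise_rate_def by linarith

text \<open>The mean spin after noise is \<open>1 - 2 * p\<close> from symbol 0 and
  \<open>2 * q - 1\<close> from symbol 1; this is the affine function of \<open>spin a\<close>
  through these two values.\<close>

lemma spin_noise_matrix:
  "(\<Sum>b\<in>UNIV. spin b * noise_matrix p q a b) = (1 - p - q) * spin a + (q - p)"
  by (cases a) (simp_all add: UNIV_bit noise_matrix_def algebra_simps)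

section \<open>Action of the kernel on Fourier coefficients\<close>

locale noisy_xor =
  fixes N :: "(int ^ 'd::finite) set" and p q :: real
  assumes finite_N: "finite N"
    and pq: "0 < p" "p < 1" "0 < q" "q < 1"
begin

abbreviation kernel :: "'d config \<Rightarrow> 'd config measure"
  where "kernel \<equiv> pca_kernel (xor_ca N) (noise_matrix p q)"

lemma measurable_kernel: "kernel \<in> borel \<rightarrow>\<^sub>M prob_algebra borel"
  using pq by (intro measurable_pca_kernel measurable_xor_ca) auto

lemma config_prob_kernel: "config_prob (kernel x)"
  using pq
  by (intro config_prob.intro config_prob_axioms.intro prob_space_pca_kernel sets_pca_kernel) auto

text \<open>Independence of the new symbols makes the mean of the character a product of mean spins.
  Expanding it yields characters of \<open>xor_ca N x\<close>, which \<open>character_dual\<close>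
  turns into characters of \<open>x\<close>.\<close>

lemma fourier_kernel:
  assumes A: "finite A"
  shows "fourier (kernel x) A = dual_step N p q (\<lambda>B. character B x) A"
proof -
  interpret config_prob "kernel x" by (rule config_prob_kernel)
  let ?F = "xor_ca N x"
  have nonneg: "0 \<le> noise_matrix p q a b" for a b
    using pq by (auto simp: noise_matrix_def)
  have "prob (cylinder A y) = (\<Prod>a\<in>A. noise_matrix p q (?F a) (y a))" for y
    using pq A emeasure_pca_kernel_cylinder[of p q A "xor_ca N" x y]
    by (simp add: measure_def prod_nonneg nonneg)
  then have "fourier (kernel x) A =
      (\<Sum>y\<in>A \<rightarrow>\<^sub>E UNIV. \<Prod>a\<in>A. spin (y a) * noise_matrix p q (?F a) (y a))"
    by (simp add: fourier_conv_prob_cylinder[OF A] character_def prod.distrib)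
  also have "\<dots> = (\<Prod>a\<in>A. \<Sum>b\<in>UNIV. spin b * noise_matrix p q (?F a) b)"
    using A by (intro prod_sum_PiE[symmetric]) auto
  also have "\<dots> = (\<Sum>B\<in>Pow A. (\<Prod>a\<in>B. (1 - p - q) * spin (?F a)) * (\<Prod>a\<in>A - B. q - p))"
    unfolding spin_noise_matrix by (rule prod_add[OF A])
  also have "\<dots> = (\<Sum>B\<in>Pow A. (1 - p - q) ^ card B * (q - p) ^ card (A - B) * character B ?F)"
    by (simp add: prod.distrib character_def mult_ac)
  also have "\<dots> = dual_step N p q (\<lambda>B. character B x) A"
    unfolding dual_step_def using A finite_N
    by (intro sum.cong refl) (auto simp: character_dual finite_subset)
  finally show ?thesis .
qed

lemma config_prob_bind_kernel:
  assumes "config_prob \<mu>"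
  shows "config_prob (\<mu> \<bind> kernel)"
proof -
  interpret config_prob \<mu> by fact
  have "\<mu> \<in> space (prob_algebra borel)"
    using prob_space_axioms by (simp add: space_prob_algebra)
  then show ?thesis
    using prob_space_bind'[OF _ measurable_kernel] sets_bind'[OF _ measurable_kernel]
    by (simp add: config_prob_def config_prob_axioms_def)
qed

text \<open>\<open>fourier_kernel\<close> is averaged over \<open>\<mu>\<close>. Passing through
  \<open>odd_set A\<close> reduces this to the formula for the measure of a set under
  \<open>\<bind>\<close>.\<close>

lemma fourier_bind_kernel:
  assumes \<mu>: "config_prob \<mu>" and A: "finite A"
  shows "fourier (\<mu> \<bind> kernel) A = dual_step N p q (fourier \<mu>) A"
proof -
  interpret config_prob \<mu> by fact
  interpret K: config_prob "kernel x" for x by (rule config_prob_kernel)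
  interpret bind: config_prob "\<mu> \<bind> kernel" using config_prob_bind_kernel[OF \<mu>] .
  have meas: "kernel \<in> \<mu> \<rightarrow>\<^sub>M subprob_algebra borel"
    using measurable_prob_algebraD[OF measurable_kernel] by simp
  have fin: "finite (dual N B)" if "B \<in> Pow A" for B
    using that A finite_N finite_dual finite_subset by blast
  have K: "measure (kernel x) (odd_set A) = (1 - dual_step N p q (\<lambda>B. character B x) A) / 2" for x
    using K.fourier_odd_set[OF A, of x] fourier_kernel[OF A, of x] by simp
  have "bind.prob (odd_set A) = (\<integral>x. measure (kernel x) (odd_set A) \<partial>\<mu>)"
    using A by (intro measure_bind[OF meas]) simp
  also have "\<dots> = (1 - (\<integral>x. dual_step N p q (\<lambda>B. character B x) A \<partial>\<mu>)) / 2"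
    unfolding K integral_divide_zero dual_step_def
    by (subst Bochner_Integration.integral_diff)
      (simp_all only: integrable_sum_character fin integrable_const lebesgue_integral_const
        prob_space scaleR_one)
  also have "(\<integral>x. dual_step N p q (\<lambda>B. character B x) A \<partial>\<mu>) = dual_step N p q (fourier \<mu>) A"
    unfolding dual_step_def using fin by (rule expectation_sum_character)
  finally show ?thesis
    using bind.fourier_odd_set[OF A] by simp
qed

lemma config_prob_kernel_power: "config_prob (kernel_power kernel t x)"
proof (induction t)
  case 0
  show ?case
    by (intro config_prob.intro config_prob_axioms.intro) (simp_all add: prob_space_return)
next
  case (Suc t)
  then show ?case by (simp add: config_prob_bind_kernel)
qed

lemma fourier_kernel_power_Suc:
  "finite A \<Longrightarrow>
    fourier (kernel_power kernel (Suc t) x) A = dual_step N p q (fourier (kernel_power kernel t x)) A"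
  by (simp add: fourier_bind_kernel config_prob_kernel_power)

lemma abs_fourier_kernel_power_le: "finite A \<Longrightarrow> \<bar>fourier (kernel_power kernel t x) A\<bar> \<le> 1"
  by (rule config_prob.abs_fourier_le[OF config_prob_kernel_power])

lemma fourier_kernel_power_empty: "fourier (kernel_power kernel t x) {} = 1"
  by (rule config_prob.fourier_empty[OF config_prob_kernel_power])

abbreviation rate :: real
  where "rate \<equiv> noise_rate p q"

lemma rate: "0 \<le> rate" "rate < 1"
  using noise_rate_less_1[OF pq] by (simp_all add: noise_rate_def)

section \<open>Convergence, uniqueness and existence of the invariant measure\<close>

lemma invariant_config_prob: "invariant_measure kernel \<pi> \<Longrightarrow> config_prob \<pi>"
  by (simp add: invariant_measure_def config_prob_def config_prob_axioms_def)

lemma fourier_invariant: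
  assumes "invariant_measure kernel \<pi>" "finite A"
  shows "fourier \<pi> A = dual_step N p q (fourier \<pi>) A"
  using fourier_bind_kernel[OF invariant_config_prob[OF assms(1)] assms(2)] assms(1)
  by (simp add: invariant_measure_def)

text \<open>The coefficients of \<open>\<pi>\<close> are a fixed point of the dual step, hence a
  constant sequence to compare with. The factor 2 bounds the initial difference of two numbers in
  \<open>[-1, 1]\<close>. It serves both the kernel powers and \<open>dual_iterate\<close>.\<close>

lemma fourier_iteration_close_invariant:
  assumes \<pi>: "invariant_measure kernel \<pi>"
    and zero: "\<And>t. f t {} = 1"
    and base: "\<And>A. finite A \<Longrightarrow> \<bar>f 0 A\<bar> \<le> 1"
    and step: "\<And>t A. finite A \<Longrightarrow> f (Suc t) A = dual_step N p q (f t) A"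
    and A: "finite A"
  shows "\<bar>f t A - fourier \<pi> A\<bar> \<le> 2 * rate ^ t"
proof -
  interpret \<pi>: config_prob \<pi> by (rule invariant_config_prob[OF \<pi>])
  have "\<bar>f 0 A - fourier \<pi> A\<bar> \<le> 2" if "finite A" for A
    using base[OF that] \<pi>.abs_fourier_le[OF that] by linarith
  then show ?thesis
    using rate(2) A
    by (intro dual_step_contraction[OF finite_N, where g = "\<lambda>_. fourier \<pi>"])
      (auto simp: zero step fourier_invariant[OF \<pi>, symmetric])
qed

lemma fourier_kernel_power_close:
  assumes "invariant_measure kernel \<pi>" "finite A"
  shows "\<bar>fourier (kernel_power kernel t x) A - fourier \<pi> A\<bar> \<le> 2 * rate ^ t"
  using assms
  by (intro fourier_iteration_close_invariant)
    (simp_all only: fourier_kernel_power_empty fourier_kernel_power_Suc abs_fourier_kernel_power_le)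

lemma rate_power_tendsto_0: "(\<lambda>t. 2 * rate ^ t) \<longlonglongrightarrow> 0"
  using rate by (intro tendsto_mult_right_zero LIMSEQ_power_zero) simp

lemma fourier_kernel_power_tendsto:
  assumes "invariant_measure kernel \<pi>" "finite A"
  shows "(\<lambda>t. fourier (kernel_power kernel t x) A) \<longlonglongrightarrow> fourier \<pi> A"
  by (rule LIM_zero_cancel, rule Lim_null_comparison[OF _ rate_power_tendsto_0])
    (simp add: fourier_kernel_power_close[OF assms])

text \<open>The coefficients of one and the same orbit \<open>kernel_power kernel t x\<close>
  converge to those of both measures.\<close>

lemma invariant_measure_unique:
  assumes "invariant_measure kernel \<pi>" "invariant_measure kernel \<pi>'"
  shows "\<pi>' = \<pi>"
proof (rule config_prob_eqI)
  show "fourier \<pi>' A = fourier \<pi> A" if "finite A" for A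
    using assms[THEN fourier_kernel_power_tendsto, OF that] LIMSEQ_unique by blast
qed (use assms in \<open>auto intro: invariant_config_prob\<close>)

text \<open>Before an invariant measure is available, the sequence is compared with its own shift by
  one time step. The increments are then dominated by a geometric series.\<close>

lemma convergent_fourier_kernel_power:
  assumes A: "finite A"
  shows "convergent (\<lambda>t. fourier (kernel_power kernel t x) A)"
proof -
  define e where "e t = fourier (kernel_power kernel t x)" for t
  have le_1: "\<bar>e t B\<bar> \<le> 1" if "finite B" for t B
    unfolding e_def by (rule abs_fourier_kernel_power_le[OF that])
  have step: "e (Suc t) B = dual_step N p q (e t) B" if "finite B" for t B
    unfolding e_def by (rule fourier_kernel_power_Suc[OF that])
  have "\<bar>e (Suc t) A - e t A\<bar> \<le> 2 * rate ^ t" for t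
  proof (rule dual_step_contraction[where f = "\<lambda>t. e (Suc t)" and g = e,
        OF finite_N less_imp_le[OF rate(2)] _ _ step step A])
    show "e (Suc s) {} = e s {}" for s
      by (simp only: e_def fourier_kernel_power_empty)
    show "\<bar>e (Suc 0) B - e 0 B\<bar> \<le> 2" if "finite B" for B
      using le_1[OF that, of "Suc 0"] le_1[OF that, of 0] by linarith
  qed
  then have bound: "norm (e (Suc t) A - e t A) \<le> 2 * rate ^ t" for t
    by simp
  have "summable (\<lambda>t. 2 * rate ^ t)"
    using rate by (intro summable_mult summable_geometric) simp
  then have "summable (\<lambda>t. e (Suc t) A - e t A)"
    by (rule summable_comparison_test'[where N = 0]) (rule bound)
  then have "convergent (\<lambda>t. e t A - e 0 A)"
    by (simp only: summable_iff_convergent sum_lessThan_telescope[of "\<lambda>t. e t A"])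
  from convergent_add[OF this convergent_const[of "e 0 A"]] show ?thesis
    by (simp add: e_def)
qed

text \<open>Limits of coefficients along the orbit of the zero configuration define
  \<open>\<pi>\<close>. The dual step is a finite sum, so it passes to the limit and fixes these
  coefficients.\<close>

lemma invariant_measure_exists: "\<exists>\<pi>. invariant_measure kernel \<pi>"
proof -
  let ?e = "\<lambda>t. fourier (kernel_power kernel t (\<lambda>_. 0))"
  define c where "c A = lim (\<lambda>t. ?e t A)" for A
  have c: "(\<lambda>t. ?e t A) \<longlonglongrightarrow> c A" if "finite A" for A
    using convergent_fourier_kernel_power[OF that] by (simp add: c_def convergent_LIMSEQ_iff)
  obtain \<pi> where \<pi>: "config_prob \<pi>" and fourier: "\<And>A. finite A \<Longrightarrow> fourier \<pi> A = c A"
    using config_prob_limit[OF config_prob_kernel_power c] by blast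
  have "\<pi> \<bind> kernel = \<pi>"
  proof (rule config_prob_eqI[OF config_prob_bind_kernel[OF \<pi>] \<pi>])
    fix A :: "(int ^ 'd) set" assume A: "finite A"
    have "finite (dual N B)" if "B \<in> Pow A" for B
      using that A finite_N finite_dual finite_subset by blast
    then have "(\<lambda>t. dual_step N p q (?e t) A) \<longlonglongrightarrow> dual_step N p q (fourier \<pi>) A"
      unfolding dual_step_def by (intro tendsto_intros) (auto simp: fourier intro: c)
    moreover have "(\<lambda>t. dual_step N p q (?e t) A) \<longlonglongrightarrow> fourier \<pi> A"
      using LIMSEQ_Suc[OF c[OF A]] by (simp only: fourier_kernel_power_Suc[OF A] fourier[OF A])
    ultimately show "fourier (\<pi> \<bind> kernel) A = fourier \<pi> A"
      unfolding fourier_bind_kernel[OF \<pi> A] by (rule LIMSEQ_unique)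
  qed
  moreover have "prob_space \<pi>" "sets \<pi> = sets borel"
    using \<pi> by (simp_all add: config_prob_def config_prob_axioms_def)
  ultimately show ?thesis by (auto simp: invariant_measure_def)
qed

text \<open>Cylinder probabilities average \<open>2 ^ card K\<close> signed coefficients, so the
  bound for coefficients carries over. It is independent of \<open>x\<close>, which gives the
  uniform convergence.\<close>

lemma prob_cylinder_close:
  assumes \<pi>: "invariant_measure kernel \<pi>" and K: "finite K"
  shows "\<bar>measure (kernel_power kernel t x) (cylinder K u) - measure \<pi> (cylinder K u)\<bar> \<le> 2 * rate ^ t"
proof -
  interpret \<pi>: config_prob \<pi> by (rule invariant_config_prob[OF \<pi>])
  interpret M: config_prob "kernel_power kernel t x" by (rule config_prob_kernel_power)
  let ?d = "\<lambda>B. character B u * (fourier (kernel_power kernel t x) B - fourier \<pi> B)"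
  have "\<bar>?d B\<bar> \<le> 2 * rate ^ t" if "B \<in> Pow K" for B
    using that K finite_subset[of B K] fourier_kernel_power_close[OF \<pi>, of B t x]
    by (simp add: abs_mult)
  then have "\<bar>\<Sum>B\<in>Pow K. ?d B\<bar> \<le> (\<Sum>B\<in>Pow K. 2 * rate ^ t)"
    by (intro order_trans[OF sum_abs sum_mono])
  also have "\<dots> = 2 * rate ^ t * 2 ^ card K"
    using K by (simp add: card_Pow)
  finally have "\<bar>(\<Sum>B\<in>Pow K. ?d B) / 2 ^ card K\<bar> \<le> 2 * rate ^ t"
    by (simp add: abs_divide divide_le_eq)
  moreover have "(\<Sum>B\<in>Pow K. ?d B) / 2 ^ card K =
      measure (kernel_power kernel t x) (cylinder K u) - measure \<pi> (cylinder K u)"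
    unfolding M.prob_cylinder[OF K] \<pi>.prob_cylinder[OF K]
    by (simp only: right_diff_distrib sum_subtractf diff_divide_distrib)
  ultimately show ?thesis by simp
qed

lemma uniformly_ergodic_kernel: "uniformly_ergodic kernel"
proof -
  obtain \<pi> where \<pi>: "invariant_measure kernel \<pi>"
    using invariant_measure_exists ..
  have "uniform_limit UNIV (\<lambda>t x. measure (kernel_power kernel t x) (cylinder K u))
      (\<lambda>x. measure \<pi> (cylinder K u)) sequentially" if K: "finite K" for K u
  proof (rule uniform_limitI)
    fix e :: real assume "0 < e"
    then have "\<forall>\<^sub>F t in sequentially. 2 * rate ^ t < e"
      by (rule order_tendstoD(2)[OF rate_power_tendsto_0])
    then show "\<forall>\<^sub>F t in sequentially. \<forall>x\<in>UNIV.
        dist (measure (kernel_power kernel t x) (cylinder K u)) (measure \<pi> (cylinder K u)) < e"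
      by eventually_elim
        (use prob_cylinder_close[OF \<pi> K] in \<open>auto simp: dist_real_def intro: le_less_trans\<close>)
  qed
  then show ?thesis
    unfolding uniformly_ergodic_def using \<pi> invariant_measure_unique by blast
qed

text \<open>Up to an error \<open>rate ^ t\<close>, the Fourier coefficients of \<open>\<pi>\<close> are those of the iteration started
  at the constant 1, which factorise over sets whose \<open>t\<close>-step neighbourhoods are disjoint.\<close>

lemma fourier_mixing:
  assumes \<pi>: "invariant_measure kernel \<pi>" and A: "finite A" and B: "finite B"
  shows "((\<lambda>k. fourier \<pi> (A \<union> (+) k ` B)) \<longlongrightarrow> fourier \<pi> A * fourier \<pi> B) cofinite"
proof (rule tendstoI)
  interpret \<pi>: config_prob \<pi> by (rule invariant_config_prob[OF \<pi>])
  let ?a = "dual_iterate N p q"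
  have close: "\<bar>?a t C - fourier \<pi> C\<bar> \<le> 2 * rate ^ t" if "finite C" for t C
  proof (rule fourier_iteration_close_invariant[OF \<pi> _ _ _ that])
    show "?a t {} = 1" for t
      by (induction t) (simp_all add: dual_step_def)
  qed simp_all
  fix e :: real assume e: "0 < e"
  have "(\<lambda>t. ?a t C) \<longlonglongrightarrow> fourier \<pi> C" if "finite C" for C
    by (rule LIM_zero_cancel, rule Lim_null_comparison[OF _ rate_power_tendsto_0])
      (simp add: close[OF that])
  then have "(\<lambda>t. ?a t A * ?a t B) \<longlonglongrightarrow> fourier \<pi> A * fourier \<pi> B"
    using A B by (intro tendsto_mult)
  then have "\<forall>\<^sub>F t in sequentially. \<bar>?a t A * ?a t B - fourier \<pi> A * fourier \<pi> B\<bar> < e / 2"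
    using e by (auto simp: dist_real_def dest!: tendstoD[where e = "e / 2"])
  moreover have "\<forall>\<^sub>F t in sequentially. 2 * rate ^ t < e / 2"
    using e by (intro order_tendstoD(2)[OF rate_power_tendsto_0]) simp
  ultimately have "\<forall>\<^sub>F t in sequentially.
      \<bar>?a t A * ?a t B - fourier \<pi> A * fourier \<pi> B\<bar> < e / 2 \<and> 2 * rate ^ t < e / 2"
    by (rule eventually_conj)
  \<comment> \<open>The time \<open>t\<close> is fixed before \<open>k\<close>: half of
    \<open>e\<close> pays for the product of the two limits, the other half for the coefficient of
    the union.\<close>
  then obtain t where t: "\<bar>?a t A * ?a t B - fourier \<pi> A * fourier \<pi> B\<bar> < e / 2" "2 * rate ^ t < e / 2"
    using eventually_happens'[OF sequentially_bot] by blast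
  have "\<forall>\<^sub>F k in cofinite. separated N t A ((+) k ` B)"
    using finite_not_separated[OF finite_N A B] by (simp add: eventually_cofinite)
  then show "\<forall>\<^sub>F k in cofinite. dist (fourier \<pi> (A \<union> (+) k ` B)) (fourier \<pi> A * fourier \<pi> B) < e"
  proof eventually_elim
    case (elim k)
    have "?a t (A \<union> (+) k ` B) = ?a t A * ?a t B"
      using dual_iterate_Un[OF finite_N A _ elim] B by (simp add: dual_iterate_translate)
    moreover have "\<bar>?a t (A \<union> (+) k ` B) - fourier \<pi> (A \<union> (+) k ` B)\<bar> \<le> 2 * rate ^ t"
      using A B by (intro close) simp
    ultimately show ?case
      using t unfolding dist_real_def by linarith
  qed
qed

text \<open>Both indicators are expanded into characters, the second over translated sets. The
  probability becomes a finite combination of coefficients to which \<open>fourier_mixing\<close>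
  applies.\<close>

lemma spatially_mixing_invariant:
  assumes \<pi>: "invariant_measure kernel \<pi>"
  shows "spatially_mixing \<pi>"
  unfolding spatially_mixing_def
proof (intro allI impI)
  interpret \<pi>: config_prob \<pi> by (rule invariant_config_prob[OF \<pi>])
  fix K L :: "(int ^ 'd) set" and u v :: "'d config"
  assume K: "finite K" and L: "finite L"
  let ?c = "\<lambda>B D. character B u * character D v / (2 ^ card K * 2 ^ card L)"
  have fin: "finite B" if "B \<in> Pow K \<or> B \<in> Pow L" for B
    using that K L finite_subset by auto
  have lim: "((\<lambda>k. \<Sum>B\<in>Pow K. \<Sum>D\<in>Pow L. ?c B D * fourier \<pi> (B \<union> (+) k ` D))
      \<longlongrightarrow> (\<Sum>B\<in>Pow K. \<Sum>D\<in>Pow L. ?c B D * (fourier \<pi> B * fourier \<pi> D))) cofinite"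
    by (intro tendsto_sum tendsto_mult tendsto_const fourier_mixing[OF \<pi>] fin) auto
  have rhs: "(\<Sum>B\<in>Pow K. \<Sum>D\<in>Pow L. ?c B D * (fourier \<pi> B * fourier \<pi> D)) =
      \<pi>.prob (cylinder K u) * \<pi>.prob (cylinder L v)"
    unfolding \<pi>.prob_cylinder[OF K] \<pi>.prob_cylinder[OF L] times_divide_times_eq sum_product
      sum_divide_distrib
    by (intro sum.cong refl) simp
  \<comment> \<open>With 0 steps \<open>separated\<close> is plain disjointness, which lets a
    product of characters be the character of the union.\<close>
  have "\<forall>\<^sub>F k in cofinite. separated N 0 K ((+) k ` L)"
    using finite_not_separated[OF finite_N K L, of 0] by (simp add: eventually_cofinite)
  then have "\<forall>\<^sub>F k in cofinite. \<pi>.prob (cylinder K u \<inter> shift k -` cylinder L v) =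
      (\<Sum>B\<in>Pow K. \<Sum>D\<in>Pow L. ?c B D * fourier \<pi> (B \<union> (+) k ` D))"
  proof eventually_elim
    case (elim k)
    then have disj: "K \<inter> (+) k ` L = {}" by simp
    have char: "character B x * character ((+) k ` D) x = character (B \<union> (+) k ` D) x"
      if "B \<in> Pow K" "D \<in> Pow L" for B D x
      using that disj fin by (intro character_Un[symmetric]) auto
    have ind: "indicator (cylinder K u \<inter> shift k -` cylinder L v) x =
        (\<Sum>B\<in>Pow K. \<Sum>D\<in>Pow L. ?c B D * character (B \<union> (+) k ` D) x)" for x
    proof -
      have "indicator (cylinder K u \<inter> shift k -` cylinder L v) x =
          indicator (cylinder K u) x * (indicator (cylinder L v) (shift k x) :: real)"
        by (simp add: indicator_def)
      also have "\<dots> = (\<Sum>B\<in>Pow K. \<Sum>D\<in>Pow L.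
          ?c B D * (character B x * character ((+) k ` D) x))"
        unfolding indicator_cylinder[OF K] indicator_cylinder[OF L] times_divide_times_eq sum_product
          sum_divide_distrib character_shift
        by (intro sum.cong refl) simp
      also have "\<dots> = (\<Sum>B\<in>Pow K. \<Sum>D\<in>Pow L. ?c B D * character (B \<union> (+) k ` D) x)"
        by (intro sum.cong refl) (simp only: char)
      finally show ?thesis .
    qed
    have "cylinder K u \<inter> shift k -` cylinder L v \<in> sets \<pi>"
    proof -
      have "shift k -` cylinder L v = cylinder ((+) k ` L) (shift (- k) v)"
        by (simp add: cylinder_def shift_def vimage_def)
      then show ?thesis using K L by simp
    qed
    then have "\<pi>.prob (cylinder K u \<inter> shift k -` cylinder L v) =
        (\<integral>x. indicator (cylinder K u \<inter> shift k -` cylinder L v) x \<partial>\<pi>)"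
      by simp
    also have "\<dots> = (\<Sum>B\<in>Pow K. \<Sum>D\<in>Pow L. ?c B D * fourier \<pi> (B \<union> (+) k ` D))"
      unfolding ind sum.cartesian_product case_prod_unfold
      using fin by (intro \<pi>.expectation_sum_character) auto
    finally show ?case .
  qed
  then show "((\<lambda>k. \<pi>.prob (cylinder K u \<inter> shift k -` cylinder L v))
      \<longlongrightarrow> \<pi>.prob (cylinder K u) * \<pi>.prob (cylinder L v)) cofinite"
    using lim unfolding rhs by (simp add: tendsto_cong)
qed

end

theorem theorem5p1:
  fixes N :: "(int ^ 'd::finite) set" and p q :: real
  assumes "finite N"
    and "0 < p" "p < 1" "0 < q" "q < 1"
  shows "uniformly_ergodic (pca_kernel (xor_ca N) (noise_matrix p q)) \<and>
    (\<forall>\<pi>. invariant_measure (pca_kernel (xor_ca N) (noise_matrix p q)) \<pi> \<longrightarrow> spatially_mixing \<pi>)"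
proof -
  interpret noisy_xor N p q by standard fact+
  show ?thesis
    using uniformly_ergodic_kernel spatially_mixing_invariant by blast
qed

end
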